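(* Let $G$ be a finite simple graph with maximum degree $\Delta(G)\geq 6$ and maximum average degree $\operatorname{mad}(G)<\frac{8}{3}$. Then $G$ admits a $2$-distance $(\Delta(G)+2)$-coloring.
   Context: For a finite simple graph $G$, $\Delta(G)$ is its maximum degree. The maximum average degree $\operatorname{mad}(G)$ is the maximum, over all (nonempty) subgraphs $H$ of $G$, of $\frac{2|E(H)|}{|V(H)|}$. A $2$-distance $k$-coloring of $G$ is a map $\phi:V(G)\to\{1,\dots,k\}$ such that $\phi(x)\neq\phi(y)$ for any two distinct vertices $x,y$ at distance at most $2$ in $G$. *)

theory Defs
  imports "Graph_Theory.Graph_Theory"
begin

text \<open>
  Finite simple graphs are represented by the locale \<^locale>\<open>pair_graph\<close>: finitely many vertices
  and a symmetric loop-free set of arcs. Each undirected edge corresponds to two opposite arcs,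
  so edges are counted as two-element vertex sets.
\<close>

definition uedges :: "'a pair_pre_digraph \<Rightarrow> 'a set set" where
  "uedges G = (\<lambda>(u, v). {u, v}) ` parcs G"

definition max_degree :: "'a pair_pre_digraph \<Rightarrow> nat" where
  "max_degree G = Max (out_degree (with_proj G) ` pverts G)"

definition nonempty_subgraphs :: "'a pair_pre_digraph \<Rightarrow> 'a pair_pre_digraph set" where
  "nonempty_subgraphs G =
    {H. pair_graph H \<and> subgraph (with_proj H) (with_proj G) \<and> pverts H \<noteq> {}}"

definition mad :: "'a pair_pre_digraph \<Rightarrow> real" where
  "mad G = Max ((\<lambda>H. 2 * real (card (uedges H)) / real (card (pverts H))) ` nonempty_subgraphs G)"

definition graph_dist :: "'a pair_pre_digraph \<Rightarrow> 'a \<Rightarrow> 'a \<Rightarrow> ereal" where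
  "graph_dist G u v = wf_digraph.\<mu> (with_proj G) (\<lambda>_. 1) u v"

definition two_distance_coloring :: "'a pair_pre_digraph \<Rightarrow> nat \<Rightarrow> ('a \<Rightarrow> nat) \<Rightarrow> bool" where
  "two_distance_coloring G k \<phi> \<longleftrightarrow>
     \<phi> ` pverts G \<subseteq> {1..k} \<and>
     (\<forall>x\<in>pverts G. \<forall>y\<in>pverts G. x \<noteq> y \<and> graph_dist G x y \<le> 2 \<longrightarrow> \<phi> x \<noteq> \<phi> y)"

text \<open>The maxima above range over finite sets, nonempty as soon as the graph has a vertex.\<close>

lemma finite_nonempty_subgraphs:
  assumes "pair_graph G"
  shows "finite (nonempty_subgraphs G)"
proof -
  interpret pair_graph G by fact
  have "nonempty_subgraphs G \<subseteq>
      (\<lambda>(V, E). \<lparr>pverts = V, parcs = E\<rparr>) ` (Pow (pverts G) \<times> Pow (parcs G))"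
  proof
    fix H assume "H \<in> nonempty_subgraphs G"
    then have "(pverts H, parcs H) \<in> Pow (pverts G) \<times> Pow (parcs G)"
      by (auto simp: nonempty_subgraphs_def subgraph_def)
    moreover have "H = (\<lambda>(V, E). \<lparr>pverts = V, parcs = E\<rparr>) (pverts H, parcs H)"
      by simp
    ultimately show "H \<in> (\<lambda>(V, E). \<lparr>pverts = V, parcs = E\<rparr>) ` (Pow (pverts G) \<times> Pow (parcs G))"
      by (rule rev_image_eqI)
  qed
  then show ?thesis
    by (rule finite_subset) (simp add: pair_finite_verts pair_finite_arcs)
qed

lemma self_in_nonempty_subgraphs:
  assumes "pair_graph G" "pverts G \<noteq> {}"
  shows "G \<in> nonempty_subgraphs G"
proof -
  interpret pair_graph G by fact
  have "wf_digraph (with_proj G)" by unfold_locales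
  with assms show ?thesis
    by (auto simp: nonempty_subgraphs_def subgraph_def compatible_def)
qed

lemma mad_less_iff:
  assumes "pair_graph G" "pverts G \<noteq> {}"
  shows "mad G < c \<longleftrightarrow>
    (\<forall>H\<in>nonempty_subgraphs G. 2 * real (card (uedges H)) / real (card (pverts H)) < c)"
  unfolding mad_def
  using finite_nonempty_subgraphs[OF assms(1)] self_in_nonempty_subgraphs[OF assms]
  by (subst Max_less_iff) auto

lemma graph_dist_le_iff:
  assumes "pair_graph G" "u \<in> pverts G"
  shows "graph_dist G u v \<le> ereal (real n) \<longleftrightarrow>
    (\<exists>p. pre_digraph.awalk (with_proj G) u p v \<and> length p \<le> n)"
proof -
  interpret pair_graph G by fact
  have cost: "awalk_cost (\<lambda>_. 1) p = real (length p)" for p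
    by (induct p) auto
  have d: "graph_dist G u v = (INF p\<in>{p. awalk u p v}. ereal (real (length p)))"
    by (simp add: graph_dist_def \<mu>_def cost)
  show ?thesis
  proof
    assume le: "graph_dist G u v \<le> ereal (real n)"
    have "graph_dist G u v < ereal (real n + 1)"
      using le by (rule le_less_trans) simp
    then obtain p where "awalk u p v" "ereal (real (length p)) < ereal (real n + 1)"
      unfolding d INF_less_iff by blast
    then show "\<exists>p. awalk u p v \<and> length p \<le> n"
      by (intro exI[of _ p]) auto
  next
    assume "\<exists>p. awalk u p v \<and> length p \<le> n"
    then obtain p where "awalk u p v" "length p \<le> n" by blast
    then show "graph_dist G u v \<le> ereal (real n)"
      unfolding d by (intro INF_lower2[of p]) auto
  qed
qed

lemma graph_dist_le_2_iff:
  assumes "pair_graph G" "u \<in> pverts G" "u \<noteq> v"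
  shows "graph_dist G u v \<le> 2 \<longleftrightarrow>
    (u, v) \<in> parcs G \<or> (\<exists>w. (u, w) \<in> parcs G \<and> (w, v) \<in> parcs G)"
proof -
  interpret pair_graph G by fact
  have two: "(2 :: ereal) = ereal (real 2)" by simp
  have "(\<exists>p. awalk u p v \<and> length p \<le> 2) \<longleftrightarrow>
    (u, v) \<in> parcs G \<or> (\<exists>w. (u, w) \<in> parcs G \<and> (w, v) \<in> parcs G)"
  proof
    assume "\<exists>p. awalk u p v \<and> length p \<le> 2"
    then obtain p where p: "awalk u p v" "length p \<le> 2" by blast
    then have E: "set p \<subseteq> parcs G" "pcas u p v" by (auto simp: awalk_def)
    consider "p = []" | e where "p = [e]" | e f where "p = [e, f]"
      using p(2) by (cases p; cases "tl p") auto
    then show "(u, v) \<in> parcs G \<or> (\<exists>w. (u, w) \<in> parcs G \<and> (w, v) \<in> parcs G)"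
      by cases (use E assms(3) in auto)
  next
    assume "(u, v) \<in> parcs G \<or> (\<exists>w. (u, w) \<in> parcs G \<and> (w, v) \<in> parcs G)"
    then consider "(u, v) \<in> parcs G" | w where "(u, w) \<in> parcs G" "(w, v) \<in> parcs G" by blast
    then show "\<exists>p. awalk u p v \<and> length p \<le> 2"
    proof cases
      case 1
      then show ?thesis using assms(2) by (intro exI[of _ "[(u, v)]"]) (auto simp: awalk_def)
    next
      case 2
      then show ?thesis using assms(2) by (intro exI[of _ "[(u, w), (w, v)]"]) (auto simp: awalk_def)
    qed
  qed
  then show ?thesis
    unfolding two graph_dist_le_iff[OF assms(1,2)] by simp
qed

end

theory Submission
  imports Defs
begin

text \<open>
  The proof is by minimal counterexample and discharging. Let \<open>D\<close> be the maximum degree of \<open>G\<close>. A graph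
  with degrees at most \<open>D\<close> is called critical if it has no colouring with \<open>D + 2\<close> colours while
  each of its proper subgraphs has one; a minimal sparse graph without such a colouring is critical.
  Deleting the edges inside a vertex set \<open>U\<close> of a critical graph leaves a colourable graph, whose
  colouring is still correct outside \<open>U\<close>. So it must be impossible to extend it to \<open>U\<close>.
  A vertex is coloured greedily as soon as at most \<open>D + 1\<close> coloured vertices are within
  distance two of it, and their number is at most the sum of the degrees of its neighbours.

  Greedy recolouring excludes vertices of degree one. Call a vertex \<^emph>\<open>weak\<close> if it has degree 3, no
  neighbour of degree above 3 and at least two neighbours of degree 2; as \<open>3 + 2 + 2 \<le> D + 1\<close>,
  weak vertices can be coloured last. Call a vertex of degree 2 \<^emph>\<open>special\<close> if it has a neighbour
  that is weak or has degree 2. Greedy recolouring shows that its other neighbour then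
  has degree exactly \<open>D\<close> (\<open>adjacent_2_vertices\<close>, \<open>nbr_of_weak\<close>).

  In discharging, a vertex \<open>v\<close> starts with charge \<open>3 d(v) - 8\<close>, so the density bound makes the total
  negative. Vertices of degree at least 4 give 1 to each neighbour of degree at most 3, and vertices
  of degree 3 that are not weak give 1 to each neighbour of degree 2. Afterwards only special vertices
  are negative, each with at least \<open>-1\<close>, while a vertex of degree \<open>D\<close> keeps at least \<open>2 D - 8 \<ge> 4\<close>.
  For \<open>D < 8\<close> this is too little if all neighbours of a vertex of degree \<open>D\<close> are special, so the
  special vertices are paid for globally. Consider the bipartite incidence structure in which every special
  vertex joins its neighbour of degree \<open>D\<close> to its \<^emph>\<open>hub\<close>, which is its weak neighbour or the
  pair that it forms with an adjacent special vertex. This structure is a forest (\<open>no_core\<close>): along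
  a cycle, the special vertices conflict with each other in an even cycle and have two free
  colours each, and even cycles are 2-choosable. A forest in which each hub has degree at least 2
  has at most twice as many edges as vertices on the other side (\<open>card_special_le\<close>), so the
  vertices of degree \<open>D\<close> can pay for all special vertices together.
\<close>

section \<open>List colouring of even cycles\<close>

text \<open>
  The union of two perfect matchings is bipartite. The induction removes a pair matched by \<open>f\<close> and
  joins the two partners that it had under \<open>g\<close>, which preserves the parity of the cycle.
\<close>

lemma alternating_set:
  fixes f g :: "'b \<Rightarrow> 'b"
  assumes "finite X"
    and "\<And>x. x \<in> X \<Longrightarrow> f x \<in> X \<and> f (f x) = x \<and> f x \<noteq> x"
    and "\<And>x. x \<in> X \<Longrightarrow> g x \<in> X \<and> g (g x) = x \<and> g x \<noteq> x"
  shows "\<exists>M. \<forall>x\<in>X. (f x \<in> M \<longleftrightarrow> x \<notin> M) \<and> (g x \<in> M \<longleftrightarrow> x \<notin> M)"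
  using assms
proof (induction "card X" arbitrary: X g rule: less_induct)
  case less
  note f = less.prems(2) and g = less.prems(3)
  show ?case
  proof (cases "X = {}")
    case False
    then obtain x where x: "x \<in> X" by blast
    define u where "u = f x"
    have u: "u \<in> X" "u \<noteq> x" "f u = x" using f[OF x] by (auto simp: u_def)
    define X1 where "X1 = X - {x, u}"
    have X1: "finite X1" "card X1 < card X"
      using less.prems(1) x by (auto simp: X1_def intro!: psubset_card_mono)
    have f1: "f z \<in> X1 \<and> f (f z) = z \<and> f z \<noteq> z" if "z \<in> X1" for z
      using f[of z] that u x unfolding X1_def by (metis Diff_iff insert_iff singletonD u_def)
    define g1 where "g1 = (if g x = u then g else g(g x := g u, g u := g x))"
    have g1: "g1 z \<in> X1 \<and> g1 (g1 z) = z \<and> g1 z \<noteq> z" if "z \<in> X1" for z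
    proof (cases "g x = u")
      case True
      then have "g u = x" using g[OF x] by metis
      then have "g z \<noteq> x" "g z \<noteq> u" using g[of z] that True unfolding X1_def by auto
      then show ?thesis using g[of z] True that by (auto simp: X1_def g1_def)
    next
      case False
      have "g u \<noteq> x" using g[OF u(1)] g[OF x] False by metis
      moreover have "g x \<noteq> g u" using g[OF u(1)] g[OF x] u(2) by metis
      moreover have "z \<in> X" "z \<noteq> x" "z \<noteq> u" using that by (auto simp: X1_def)
      moreover have gz: "g z \<noteq> g x" "g z \<noteq> g u"
        using g[OF \<open>z \<in> X\<close>] g[OF x] g[OF u(1)] \<open>z \<noteq> x\<close> \<open>z \<noteq> u\<close> by metis+
      moreover have "g z \<noteq> x" if "z \<noteq> g x" using g[OF \<open>z \<in> X\<close>] that by metis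
      moreover have "g z \<noteq> u" if "z \<noteq> g u" using g[OF \<open>z \<in> X\<close>] that by metis
      ultimately show ?thesis
        using g[of z] g[OF x] g[OF u(1)] False gz
        by (cases "z = g x"; cases "z = g u") (simp_all add: X1_def g1_def)
    qed
    from less.hyps[OF X1(2,1) f1 g1] obtain M where
      M: "\<And>z. z \<in> X1 \<Longrightarrow> (f z \<in> M \<longleftrightarrow> z \<notin> M) \<and> (g1 z \<in> M \<longleftrightarrow> z \<notin> M)"
      by blast
    \<comment> \<open>the side of \<open>x\<close> is forced by its partner under \<open>g\<close>, unless \<open>x\<close> and \<open>u\<close> are matched twice\<close>
    define b where "b \<longleftrightarrow> g x = u \<or> g x \<notin> M"
    define N where "N = (M \<inter> X1) \<union> (if b then {x} else {u})"
    have xN: "x \<in> N \<longleftrightarrow> b" "u \<in> N \<longleftrightarrow> \<not> b" using u(2) by (auto simp: N_def X1_def)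
    have zN: "z \<in> N \<longleftrightarrow> z \<in> M" if "z \<in> X1" for z using that by (auto simp: N_def X1_def)
    have fN: "f z \<in> N \<longleftrightarrow> z \<notin> N" if "z \<in> X" for z
    proof (cases "z \<in> X1")
      case True then show ?thesis using M zN f1 by blast
    next
      case False
      then have "z = x \<or> z = u" using that by (auto simp: X1_def)
      moreover have "f x = u" by (simp add: u_def)
      ultimately show ?thesis using xN u(3) by auto
    qed
    have gN: "g z \<in> N \<longleftrightarrow> z \<notin> N" if z: "z \<in> X" for z
    proof (cases "g x = u")
      case True
      then have gu: "g u = x" using g[OF x] by auto
      show ?thesis
      proof (cases "z \<in> X1")
        case z1: True then show ?thesis using M[OF z1] zN[OF z1] zN[of "g z"] g1[OF z1] True
          by (auto simp: g1_def)
      next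
        case False
        then have "z = x \<or> z = u" using z by (auto simp: X1_def)
        then show ?thesis using xN True gu by auto
      qed
    next
      case False
      have gu: "g u \<noteq> x" using g[OF u(1)] g[OF x] False by metis
      have ne: "g x \<noteq> g u" using g[OF u(1)] g[OF x] u(2) by metis
      have in1: "g x \<in> X1" "g u \<in> X1" using g[OF u(1)] g[OF x] False gu by (auto simp: X1_def)
      have "g1 (g x) = g u" using ne False by (auto simp: g1_def)
      then have opp: "g u \<in> M \<longleftrightarrow> g x \<notin> M" using M[OF in1(1)] by auto
      have b: "b \<longleftrightarrow> g x \<notin> M" using False by (auto simp: b_def)
      consider "z = x" | "z = u" | "z = g x" | "z = g u" | "z \<in> X1" "z \<noteq> g x" "z \<noteq> g u"
        using z by (auto simp: X1_def)
      then show ?thesis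
      proof cases
        case 1 then show ?thesis using zN[OF in1(1)] xN b by auto
      next
        case 2 then show ?thesis using zN[OF in1(2)] xN b opp by auto
      next
        case 3 then show ?thesis using zN[OF in1(1)] xN b g[OF x] by auto
      next
        case 4 then show ?thesis using zN[OF in1(2)] xN b opp g[OF u(1)] by auto
      next
        case 5
        then have "g1 z = g z" using False by (auto simp: g1_def)
        then show ?thesis using M[OF 5(1)] zN[OF 5(1)] zN[of "g z"] g1[OF 5(1)] by auto
      qed
    qed
    show ?thesis using fN gN by blast
  qed auto
qed

text \<open>
  This is 2-choosability of even cycles, in a form that survives the removal of vertices: the components
  are paths and cycles directed by \<open>nxt\<close>, and the last vertex of a path needs only one colour.
  If some vertex has a colour that its successor does not have, it takes this colour, and the
  predecessor may lose the colour but also loses its successor. Otherwise lists can only grow along \<open>nxt\<close>,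
  so they are constant on every cycle, and \<open>M\<close> tells which of two common colours to take.
\<close>

lemma list_coloring_alternating:
  fixes nxt :: "'b \<Rightarrow> 'b" and L :: "'b \<Rightarrow> nat set"
  assumes "finite X" "inj_on nxt X"
    and "\<And>x. x \<in> X \<Longrightarrow> nxt x \<in> M \<longleftrightarrow> x \<notin> M"
    and "\<And>x. x \<in> X \<Longrightarrow> finite (L x) \<and> (if nxt x \<in> X then 2 else 1) \<le> card (L x)"
  shows "\<exists>c. \<forall>x\<in>X. c x \<in> L x \<and> (nxt x \<in> X \<longrightarrow> c x \<noteq> c (nxt x))"
  using assms
proof (induction "card X" arbitrary: X L rule: less_induct)
  case less
  note M = less.prems(3) and L = less.prems(4)
  have nofix: "nxt x \<noteq> x" if "x \<in> X" for x using M[OF that] by auto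
  show ?case
  proof (cases "\<exists>s k. s \<in> X \<and> k \<in> L s \<and> (nxt s \<in> X \<longrightarrow> k \<notin> L (nxt s))")
    case True
    then obtain s k where s: "s \<in> X" "k \<in> L s" "nxt s \<in> X \<longrightarrow> k \<notin> L (nxt s)" by blast
    define L1 where "L1 = (\<lambda>x. if nxt x = s then L x - {k} else L x)"
    have "card (X - {s}) < card X" using s(1) less.prems(1) by (intro psubset_card_mono) auto
    moreover have "finite (L1 x) \<and> (if nxt x \<in> X - {s} then 2 else 1) \<le> card (L1 x)"
      if "x \<in> X - {s}" for x
    proof -
      have x: "x \<in> X" using that by simp
      have "nxt x \<in> X" if "nxt x = s" using that s(1) by simp
      then show ?thesis using L[OF x] by (auto simp: L1_def card_Diff_singleton_if)
    qed
    ultimately have "\<exists>c. \<forall>x\<in>X - {s}. c x \<in> L1 x \<and> (nxt x \<in> X - {s} \<longrightarrow> c x \<noteq> c (nxt x))"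
      by (intro less.hyps finite_Diff less.prems(1) inj_on_subset[OF less.prems(2)] M) simp_all
    then obtain c where c: "\<And>x. x \<in> X - {s} \<Longrightarrow> c x \<in> L1 x \<and> (nxt x \<in> X - {s} \<longrightarrow> c x \<noteq> c (nxt x))"
      by blast
    define c' where "c' = c(s := k)"
    have "c' x \<in> L x \<and> (nxt x \<in> X \<longrightarrow> c' x \<noteq> c' (nxt x))" if x: "x \<in> X" for x
    proof (cases "x = s")
      case True
      have "c (nxt s) \<in> L (nxt s)" if "nxt s \<in> X"
        using c[of "nxt s"] nofix[OF s(1)] that by (auto simp: L1_def split: if_splits)
      then show ?thesis using True s nofix[OF s(1)] by (auto simp: c'_def)
    next
      case False
      then have cx: "c x \<in> L1 x" "nxt x \<in> X \<Longrightarrow> nxt x \<noteq> s \<Longrightarrow> c x \<noteq> c (nxt x)" using c[of x] x by auto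
      show ?thesis
      proof (cases "nxt x = s")
        case True then show ?thesis using cx(1) False by (simp add: c'_def L1_def)
      next
        case ns: False then show ?thesis using cx False by (simp add: c'_def L1_def)
      qed
    qed
    then show ?thesis by blast
  next
    case False
    then have nx: "nxt x \<in> X" if "x \<in> X" for x
    proof -
      have "0 < card (L x)" using L[OF that] by (cases "nxt x \<in> X") auto
      then have "L x \<noteq> {}" by (simp add: card_gt_0_iff)
      then show ?thesis using False that by blast
    qed
    have sub: "L x \<subseteq> L (nxt x)" if "x \<in> X" for x using False nx that by blast
    have img: "nxt ` X = X" using nx less.prems(1,2) by (intro endo_inj_surj) auto
    have "(\<Sum>x\<in>X. card (L (nxt x))) = (\<Sum>x\<in>X. card (L x))"
      using sum.reindex[OF less.prems(2), of "\<lambda>x. card (L x)"] img by (simp add: o_def)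
    then have sums: "(\<Sum>x\<in>X. card (L x)) = (\<Sum>x\<in>X. card (L (nxt x)))" by simp
    have le: "card (L x) \<le> card (L (nxt x))" if "x \<in> X" for x
      using sub[OF that] L nx that by (intro card_mono) auto
    have "card (L x) = card (L (nxt x))" if "x \<in> X" for x
      by (rule sum_mono_inv[OF sums le that less.prems(1)])
    then have eq: "L (nxt x) = L x" if "x \<in> X" for x
      using card_subset_eq[OF _ sub[OF that]] L[OF nx[OF that]] that by metis
    define c where "c = (\<lambda>x. if x \<in> M then Min (L x) else Max (L x))"
    have ne: "Min (L x) \<noteq> Max (L x)" "Min (L x) \<in> L x" "Max (L x) \<in> L x" if "x \<in> X" for x
    proof -
      have 2: "finite (L x)" "2 \<le> card (L x)" using L[OF that] nx[OF that] by auto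
      then have nz: "L x \<noteq> {}" by auto
      show "Min (L x) \<in> L x" "Max (L x) \<in> L x" using 2 nz by auto
      show "Min (L x) \<noteq> Max (L x)"
      proof
        assume "Min (L x) = Max (L x)"
        then have "z = Min (L x)" if "z \<in> L x" for z
          using Max_ge[OF 2(1) that] Min_le[OF 2(1) that] by simp
        then have "L x \<subseteq> {Min (L x)}" by blast
        then have "card (L x) \<le> 1" using card_mono[of "{Min (L x)}"] by simp
        then show False using 2 by simp
      qed
    qed
    have "c x \<in> L x \<and> (nxt x \<in> X \<longrightarrow> c x \<noteq> c (nxt x))" if "x \<in> X" for x
      using ne[OF that] eq[OF that] M[OF that] by (auto simp: c_def)
    then show ?thesis by blast
  qed
qed

text \<open>
  Read \<open>x\<close> as an edge between the vertices \<open>a x\<close> and \<open>h x\<close> of a bipartite graph. With at least as many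
  edges as vertices there is a cycle; here it appears as a minimal edge set \<open>Y\<close> with that property,
  for which a double count forces all degrees to be exactly 2.
\<close>

lemma two_regular_core:
  assumes "finite X" "X \<noteq> {}" "card (a ` X) + card (h ` X) \<le> card X"
  shows "\<exists>Y\<subseteq>X. Y \<noteq> {} \<and> (\<forall>y\<in>Y. card {z \<in> Y. a z = a y} = 2 \<and> card {z \<in> Y. h z = h y} = 2)"
proof -
  let ?P = "\<lambda>Y. Y \<subseteq> X \<and> Y \<noteq> {} \<and> card (a ` Y) + card (h ` Y) \<le> card Y"
  define Y where "Y = arg_min card ?P"
  have Y: "?P Y" and min: "\<And>Z. ?P Z \<Longrightarrow> card Y \<le> card Z"
    unfolding Y_def using arg_min_nat_lemma[of ?P X card] assms by blast+
  have fin: "finite Y" using Y assms(1) finite_subset by blast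
  have pos: "0 < card (a ` Y)" "0 < card (h ` Y)" using Y fin by (auto simp: card_gt_0_iff)
  \<comment> \<open>by minimality the removal of an edge loses no vertex, so there are no vertices of degree one\<close>
  have rem: "a ` (Y - {y}) = a ` Y \<and> h ` (Y - {y}) = h ` Y
      \<and> card Y = card (a ` Y) + card (h ` Y)" if y: "y \<in> Y" for y
  proof -
    have "Y - {y} \<noteq> {}"
    proof
      assume "Y - {y} = {}"
      then have "Y = {y}" using y by auto
      then show False using Y pos by simp
    qed
    moreover have lt: "card (Y - {y}) < card Y" using y fin by (intro card_Diff1_less)
    ultimately have "\<not> card (a ` (Y - {y})) + card (h ` (Y - {y})) \<le> card (Y - {y})"
      using min[of "Y - {y}"] Y leD[of "card Y"] by blast
    moreover have "card (Y - {y}) = card Y - 1" using y by simp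
    ultimately have ge: "card Y \<le> card (a ` (Y - {y})) + card (h ` (Y - {y}))" by linarith
    have le: "card (a ` (Y - {y})) \<le> card (a ` Y)" "card (h ` (Y - {y})) \<le> card (h ` Y)"
      using fin by (auto intro!: card_mono)
    have "card (a ` (Y - {y})) = card (a ` Y)" "card (h ` (Y - {y})) = card (h ` Y)"
      "card Y = card (a ` Y) + card (h ` Y)" using ge le Y by linarith+
    then show ?thesis using fin by (intro conjI card_subset_eq image_mono finite_imageI) auto
  qed
  have class2: "2 \<le> card {z \<in> Y. k z = t}"
    if k: "\<And>y. y \<in> Y \<Longrightarrow> k ` (Y - {y}) = k ` Y" and t: "t \<in> k ` Y" for k :: "_ \<Rightarrow> 'z" and t
  proof -
    obtain y where y: "y \<in> Y" "k y = t" using t by blast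
    have "t \<in> k ` (Y - {y})" using k[OF y(1)] t by simp
    then obtain z where "z \<in> Y" "z \<noteq> y" "k z = t" by blast
    then have "{y, z} \<subseteq> {z \<in> Y. k z = t}" "card {y, z} = 2" using y by auto
    then show ?thesis using card_mono[of "{z \<in> Y. k z = t}" "{y, z}"] fin by simp
  qed
  have split: "card Y = (\<Sum>t\<in>k ` Y. card {z \<in> Y. k z = t})" for k :: "_ \<Rightarrow> 'z"
    using sum.image_gen[OF fin, of "\<lambda>_. 1::nat" k] by simp
  have half: "2 * card (k ` Y) \<le> card Y" and
    exact: "2 * card (k ` Y) = card Y \<Longrightarrow> y \<in> Y \<Longrightarrow> card {z \<in> Y. k z = k y} = 2"
    if k: "\<And>y. y \<in> Y \<Longrightarrow> k ` (Y - {y}) = k ` Y" for k :: "_ \<Rightarrow> 'z" and y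
  proof -
    have "(\<Sum>t\<in>k ` Y. 2) \<le> (\<Sum>t\<in>k ` Y. card {z \<in> Y. k z = t})"
      by (intro sum_mono class2 k)
    then show "2 * card (k ` Y) \<le> card Y" using split[of k] by simp
    assume "2 * card (k ` Y) = card Y" and y: "y \<in> Y"
    then have "(\<Sum>t\<in>k ` Y. 2) = (\<Sum>t\<in>k ` Y. card {z \<in> Y. k z = t})"
      using split[of k] by simp
    from sum_mono_inv[OF this class2[OF k] imageI[OF y] finite_imageI[OF fin]]
    show "card {z \<in> Y. k z = k y} = 2" by simp
  qed
  have a: "y \<in> Y \<Longrightarrow> a ` (Y - {y}) = a ` Y" and h: "y \<in> Y \<Longrightarrow> h ` (Y - {y}) = h ` Y" for y
    using rem by auto
  have "card Y = card (a ` Y) + card (h ` Y)" using rem Y by blast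
  then have "2 * card (a ` Y) = card Y" "2 * card (h ` Y) = card Y"
    using half[OF a] half[OF h] by linarith+
  then have "\<forall>y\<in>Y. card {z \<in> Y. a z = a y} = 2 \<and> card {z \<in> Y. h z = h y} = 2"
    by (intro ballI conjI exact[OF a] exact[OF h])
  then show ?thesis using Y by blast
qed

text \<open>
  The edges of a disjoint union of even cycles can be coloured from lists of size 2. Orienting the
  pairs with a common \<open>a\<close> out of \<open>M\<close> and the pairs with a common \<open>h\<close> into \<open>M\<close> directs the
  conflicts along the cycles.
\<close>

lemma list_coloring_two_regular:
  fixes L :: "'b \<Rightarrow> nat set"
  assumes fin: "finite Y"
    and a: "\<And>y. y \<in> Y \<Longrightarrow> card {z \<in> Y. a z = a y} = 2"
    and h: "\<And>y. y \<in> Y \<Longrightarrow> card {z \<in> Y. h z = h y} = 2"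
    and L: "\<And>y. y \<in> Y \<Longrightarrow> finite (L y) \<and> 2 \<le> card (L y)"
  shows "\<exists>c. \<forall>y\<in>Y. c y \<in> L y \<and> (\<forall>z\<in>Y. z \<noteq> y \<and> (a z = a y \<or> h z = h y) \<longrightarrow> c z \<noteq> c y)"
proof -
  have mate: "\<exists>f. \<forall>y\<in>Y. f y \<noteq> y \<and> {z \<in> Y. k z = k y} = {y, f y}"
    if k: "\<And>y. y \<in> Y \<Longrightarrow> card {z \<in> Y. k z = k y} = 2" for k :: "'b \<Rightarrow> 'z"
  proof (intro bchoice ballI)
    fix y assume y: "y \<in> Y"
    obtain u v where uv: "{z \<in> Y. k z = k y} = {u, v}" "u \<noteq> v" using k[OF y] by (auto simp: card_2_iff)
    moreover have "y \<in> {u, v}" using y unfolding uv(1)[symmetric] by simp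
    ultimately consider "y = u" | "y = v" by blast
    then show "\<exists>x. x \<noteq> y \<and> {z \<in> Y. k z = k y} = {y, x}"
    proof cases
      case 1 then show ?thesis using uv by (intro exI[of _ v]) auto
    next
      case 2 then show ?thesis using uv by (intro exI[of _ u]) (simp add: insert_commute)
    qed
  qed
  have inv: "f y \<in> Y \<and> f (f y) = y \<and> f y \<noteq> y"
    if f: "\<And>y. y \<in> Y \<Longrightarrow> f y \<noteq> y \<and> {z \<in> Y. k z = k y} = {y, f y}" and y: "y \<in> Y" for k :: "'b \<Rightarrow> 'z" and f y
  proof -
    have "f y \<in> {z \<in> Y. k z = k y}" using f[OF y] by simp
    then have fy: "f y \<in> Y" "k (f y) = k y" by auto
    then have "{f y, f (f y)} = {y, f y}" using f[OF y] f[OF fy(1)] by simp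
    then show ?thesis using fy f[OF y] f[OF fy(1)] by (metis doubleton_eq_iff)
  qed
  obtain f where f: "\<And>y. y \<in> Y \<Longrightarrow> f y \<noteq> y \<and> {z \<in> Y. a z = a y} = {y, f y}" using mate[of a] a by blast
  obtain g where g: "\<And>y. y \<in> Y \<Longrightarrow> g y \<noteq> y \<and> {z \<in> Y. h z = h y} = {y, g y}" using mate[of h] h by blast
  have fi: "f y \<in> Y \<and> f (f y) = y \<and> f y \<noteq> y" if y: "y \<in> Y" for y
    using inv[of f a y] f y by presburger
  have gi: "g y \<in> Y \<and> g (g y) = y \<and> g y \<noteq> y" if y: "y \<in> Y" for y
    using inv[of g h y] g y by presburger
  obtain M where M: "\<And>x. x \<in> Y \<Longrightarrow> (f x \<in> M \<longleftrightarrow> x \<notin> M) \<and> (g x \<in> M \<longleftrightarrow> x \<notin> M)"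
    using alternating_set[OF fin fi gi] by blast
  define nxt where "nxt = (\<lambda>x. if x \<in> M then f x else g x)"
  have inj: "inj_on nxt Y"
  proof (rule inj_onI)
    fix x y assume xy: "x \<in> Y" "y \<in> Y" "nxt x = nxt y"
    then have "x \<in> M \<longleftrightarrow> y \<in> M" using M[OF xy(1)] M[OF xy(2)] by (auto simp: nxt_def split: if_splits)
    then show "x = y" using xy fi gi by (metis nxt_def)
  qed
  have "nxt x \<in> M \<longleftrightarrow> x \<notin> M" if "x \<in> Y" for x using M[OF that] by (auto simp: nxt_def)
  moreover have "nxt x \<in> Y" if "x \<in> Y" for x using fi gi that by (auto simp: nxt_def)
  ultimately have "\<exists>c. \<forall>x\<in>Y. c x \<in> L x \<and> c x \<noteq> c (nxt x)"
    using list_coloring_alternating[OF fin inj, of M L] L by auto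
  then obtain c where c: "\<And>x. x \<in> Y \<Longrightarrow> c x \<in> L x \<and> c x \<noteq> c (nxt x)"
    by blast
  have cf: "c (f x) \<noteq> c x" and cg: "c (g x) \<noteq> c x" if x: "x \<in> Y" for x
    using c[OF x] c[of "f x"] c[of "g x"] M[OF x] fi[OF x] gi[OF x]
    by (auto simp: nxt_def split: if_splits)
  have "c z \<noteq> c y" if "y \<in> Y" "z \<in> Y" "z \<noteq> y" "a z = a y \<or> h z = h y" for y z
  proof -
    have "z = f y \<or> z = g y" using f[OF that(1)] g[OF that(1)] that by blast
    then show ?thesis using cf cg that(1) by blast
  qed
  then show ?thesis using c by blast
qed

section \<open>Critical graphs and recolouring\<close>

definition nbrs :: "('a \<times> 'a) set \<Rightarrow> 'a \<Rightarrow> 'a set" where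
  "nbrs E v = {w. (v, w) \<in> E}"

text \<open>
  The vertices at distance one or two, that is, those that must not share a colour with \<open>v\<close>.
\<close>

definition near :: "('a \<times> 'a) set \<Rightarrow> 'a \<Rightarrow> 'a set" where
  "near E v = (\<Union>m\<in>nbrs E v. insert m (nbrs E m)) - {v}"

definition coloring_on :: "nat \<Rightarrow> ('a \<times> 'a) set \<Rightarrow> 'a set \<Rightarrow> ('a \<Rightarrow> nat) \<Rightarrow> bool" where
  "coloring_on k E S c \<longleftrightarrow> (\<forall>u\<in>S. c u \<in> {1..k} \<and> (\<forall>w\<in>near E u \<inter> S. c w \<noteq> c u))"

lemma near_sym: "sym E \<Longrightarrow> w \<in> near E u \<longleftrightarrow> u \<in> near E w"
  unfolding near_def nbrs_def by (auto dest: symD)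

lemma another_element:
  assumes "2 \<le> card A"
  shows "\<exists>z\<in>A. z \<noteq> y"
proof (rule ccontr)
  assume "\<not> ?thesis"
  then have "A \<subseteq> {y}" by blast
  then have "card A \<le> card {y}" by (intro card_mono) auto
  then show False using assms by simp
qed

lemma free_color:
  assumes "finite F" "card F < k"
  shows "\<exists>j\<in>{1..k::nat}. j \<notin> F"
proof (rule ccontr)
  assume "\<not> ?thesis"
  then have "{1..k} \<subseteq> F" by blast
  then have "card {1..k} \<le> card F" by (rule card_mono[OF assms(1)])
  then show False using assms(2) by simp
qed

text \<open>
  Graphs are represented by their arc sets alone: deleting vertices is then a special case of deleting
  edges, because isolated vertices do no harm to a colouring. The bound \<open>D\<close> is not tied to the maximum
  degree of \<open>E\<close>, which may drop when edges are deleted, while the number of colours must not.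
\<close>

locale critical_graph =
  fixes E :: "('a \<times> 'a) set" and D :: nat
  assumes fin: "finite E" and sym: "sym E" and irr: "irrefl E"
    and deg: "card (nbrs E v) \<le> D" and D: "6 \<le> D"
    and critical: "\<And>F. F \<subset> E \<Longrightarrow> sym F \<Longrightarrow> \<exists>c. coloring_on (D + 2) F UNIV c"
    and uncolorable: "\<not> coloring_on (D + 2) E UNIV c"
begin

abbreviation "N \<equiv> nbrs E"
abbreviation "d v \<equiv> card (N v)"

text \<open>
  These vertices can always be coloured last, see \<open>card_near_weak\<close>.
\<close>

definition weak :: "'a \<Rightarrow> bool" where
  "weak v \<longleftrightarrow> d v = 3 \<and> (\<forall>w\<in>N v. d w \<le> 3) \<and> 2 \<le> card {w \<in> N v. d w = 2}"

lemma N_sym: "w \<in> N v \<longleftrightarrow> v \<in> N w"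
  using sym by (auto simp: nbrs_def dest: symD)

lemma N_irr: "v \<notin> N v"
  using irr by (auto simp: nbrs_def irrefl_def)

lemma fin_N [simp, intro]: "finite (N v)"
proof -
  have "N v \<subseteq> snd ` E" unfolding nbrs_def using image_iff by fastforce
  then show ?thesis using fin finite_subset by blast
qed

lemma fin_near [simp, intro]: "finite (near E v)"
  by (auto simp: near_def)

lemma near_N: "w \<in> N v \<Longrightarrow> w \<in> near E v"
  using N_irr[of v] by (auto simp: near_def)

lemma near_2: "m \<in> N v \<Longrightarrow> w \<in> N m \<Longrightarrow> w \<noteq> v \<Longrightarrow> w \<in> near E v"
  by (auto simp: near_def)

lemma card_near_le: "card (near E v) \<le> (\<Sum>m\<in>N v. d m)"
proof -
  have "near E v = (\<Union>m\<in>N v. insert m (N m) - {v})" by (auto simp: near_def)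
  also have "card \<dots> \<le> (\<Sum>m\<in>N v. card (insert m (N m) - {v}))"
    by (rule card_UN_le) simp
  also have "\<dots> = (\<Sum>m\<in>N v. d m)"
  proof (rule sum.cong)
    fix m assume "m \<in> N v"
    then have "v \<in> N m" "m \<noteq> v" using N_sym N_irr by auto
    then show "card (insert m (N m) - {v}) = d m" using N_irr[of m] by simp
  qed simp
  finally show ?thesis .
qed

lemma color_one_more:
  assumes c: "coloring_on (D + 2) E S c" and u: "u \<notin> S"
    and few: "card (near E u \<inter> S) \<le> D + 1"
  shows "\<exists>c'. coloring_on (D + 2) E (insert u S) c'"
proof -
  have "card (c ` (near E u \<inter> S)) < D + 2"
    using few card_image_le[of "near E u \<inter> S" c] by simp
  then obtain j where j: "j \<in> {1..D + 2}" "j \<notin> c ` (near E u \<inter> S)"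
    using free_color[of "c ` (near E u \<inter> S)" "D + 2"] fin_near by blast
  have "coloring_on (D + 2) E (insert u S) (c(u := j))"
    unfolding coloring_on_def
  proof (intro ballI conjI)
    fix x assume x: "x \<in> insert u S"
    show "(c(u := j)) x \<in> {1..D + 2}" using x c j(1) by (auto simp: coloring_on_def)
    fix w assume w: "w \<in> near E x \<inter> insert u S"
    have "w \<noteq> x" using w by (auto simp: near_def)
    have ux: "u \<in> near E x \<Longrightarrow> x \<in> near E u" using near_sym[OF sym] by metis
    consider "x = u" | "w = u" "x \<noteq> u" | "x \<noteq> u" "w \<noteq> u" by blast
    then show "(c(u := j)) w \<noteq> (c(u := j)) x"
    proof cases
      case 1
      then have "c w \<in> c ` (near E u \<inter> S)" using w \<open>w \<noteq> x\<close> by blast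
      then show ?thesis using 1 \<open>w \<noteq> x\<close> j(2) by auto
    next
      case 2
      then have "c x \<in> c ` (near E u \<inter> S)" using w x ux by blast
      then show ?thesis using 2 j(2) by auto
    next
      case 3
      then show ?thesis using c x w by (auto simp: coloring_on_def)
    qed
  qed
  then show ?thesis by blast
qed

lemma color_greedily:
  assumes "coloring_on (D + 2) E S c" "finite W" "\<And>w. w \<in> W \<Longrightarrow> card (near E w) \<le> D + 1"
  shows "\<exists>c'. coloring_on (D + 2) E (S \<union> W) c'"
  using assms(2,3)
proof (induction W)
  case empty then show ?case using assms(1) by auto
next
  case (insert w W)
  then obtain c' where c': "coloring_on (D + 2) E (S \<union> W) c'" by auto
  show ?case
  proof (cases "w \<in> S \<union> W")
    case True then show ?thesis using c' by (metis Un_insert_right insert_absorb)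
  next
    case False
    have "card (near E w \<inter> (S \<union> W)) \<le> card (near E w)" by (intro card_mono) auto
    also have "\<dots> \<le> D + 1" using insert by simp
    finally show ?thesis using color_one_more[OF c' False] by simp
  qed
qed

lemma uncolor:
  assumes F: "F \<subset> E" "sym F"
    and keep: "\<And>u w. u \<notin> U \<Longrightarrow> w \<notin> U \<Longrightarrow> w \<in> near E u \<Longrightarrow> w \<in> near F u"
  shows "\<exists>c. coloring_on (D + 2) E (- U) c"
proof -
  obtain c where "coloring_on (D + 2) F UNIV c" using critical F by blast
  then have "coloring_on (D + 2) E (- U) c" using keep by (auto simp: coloring_on_def)
  then show ?thesis by blast
qed

text \<open>
  A path of length at most two between vertices outside \<open>U\<close> uses no edge inside \<open>U\<close>, so all conflicts
  outside \<open>U\<close> remain when these edges are deleted.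
\<close>

lemma uncolor_set:
  assumes "u \<in> U" "v \<in> U" "v \<in> N u"
  shows "\<exists>c. coloring_on (D + 2) E (- U) c"
proof (rule uncolor[of "E - U \<times> U"])
  show "E - U \<times> U \<subset> E" using assms by (auto simp: nbrs_def)
  show "sym (E - U \<times> U)" using sym by (auto simp: sym_def)
  fix u w assume "u \<notin> U" "w \<notin> U" "w \<in> near E u"
  then show "w \<in> near (E - U \<times> U) u" by (auto simp: near_def nbrs_def)
qed

text \<open>
  A leaf is not the middle of any path, so uncolouring the leaf alone is enough; \<open>uncolor_set\<close> would
  also uncolour its neighbour.
\<close>

lemma degree_ne_1: "d u \<noteq> 1"
proof
  assume "d u = 1"
  then obtain w where w: "N u = {w}" by (auto simp: card_1_singleton_iff)
  have wu: "N v \<inter> {u} = (if v = w then {u} else {})" for v using N_sym[of u v] w by auto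
  define F where "F = E - {(u, w), (w, u)}"
  have "\<exists>c. coloring_on (D + 2) E (- {u}) c"
  proof (rule uncolor)
    show "F \<subset> E" "sym F" using w sym by (auto simp: F_def nbrs_def sym_def)
    fix x y assume xy: "x \<notin> {u}" "y \<notin> {u}" "y \<in> near E x"
    have "m \<noteq> u" if "m \<in> N x" "y \<in> N m" for m
      using that xy w wu[of x] by (auto simp: near_def nbrs_def split: if_splits)
    then show "y \<in> near F x" using xy w unfolding near_def nbrs_def F_def by auto
  qed
  then obtain c where c: "coloring_on (D + 2) E (- {u}) c" by blast
  have "card (near E u \<inter> - {u}) \<le> card (near E u)" by (intro card_mono) auto
  also have "\<dots> \<le> D" using card_near_le[of u] w deg[of w] by simp
  finally have "\<exists>c'. coloring_on (D + 2) E (insert u (- {u})) c'"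
    using color_one_more[OF c] by simp
  then show False using uncolorable by (simp add: Compl_eq_Diff_UNIV insert_UNIV)
qed

lemma two_nbrs:
  assumes "d x = 2" "p \<in> N x"
  obtains a where "N x = {a, p}" "a \<noteq> p"
proof -
  obtain u v where uv: "N x = {u, v}" "u \<noteq> v" using assms(1) unfolding card_2_iff by blast
  then consider "p = u" | "p = v" using assms(2) by blast
  then show thesis
  proof cases
    case 1 then show ?thesis using uv that[of v] by (simp add: insert_commute)
  next
    case 2 then show ?thesis using uv that[of u] by simp
  qed
qed

lemma card_near_2: "N x = {a, p} \<Longrightarrow> a \<noteq> p \<Longrightarrow> card (near E x) \<le> d a + d p"
  using card_near_le[of x] by simp

lemma card_near_minus:
  assumes "R \<subseteq> near E x" "R \<inter> S = {}"
  shows "card (near E x \<inter> S) + card R \<le> card (near E x)"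
proof -
  have f: "finite R" using assms(1) finite_subset by blast
  have "card (near E x \<inter> S) + card R = card ((near E x \<inter> S) \<union> R)"
    using f assms by (intro card_Un_disjoint[symmetric]) auto
  also have "\<dots> \<le> card (near E x)" using assms by (intro card_mono) auto
  finally show ?thesis .
qed

text \<open>
  If \<open>a\<close> had degree below \<open>D\<close>, then \<open>y\<close> could be recoloured while \<open>x\<close> is uncoloured, and \<open>x\<close> after it.
\<close>

lemma adjacent_2_vertices:
  assumes x: "d x = 2" "N x = {a, y}" "a \<noteq> y" and y: "d y = 2"
  shows "d a = D"
proof (rule ccontr)
  assume "d a \<noteq> D"
  then have da: "d a < D" using deg[of a] by simp
  have xy: "x \<in> N y" "y \<in> N x" "x \<noteq> y" using x N_sym N_irr by auto
  obtain b where b: "N y = {b, x}" "b \<noteq> x" using two_nbrs[OF y xy(1)] .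
  obtain c where c: "coloring_on (D + 2) E (- {x, y}) c" using uncolor_set[of x "{x,y}" y] xy by auto
  have "card (near E y) \<le> D + 2" using card_near_2[OF b] x(1) deg[of b] by simp
  then have "card (near E y \<inter> - {x, y}) \<le> D + 1"
    using card_near_minus[of "{x}" y "- {x, y}"] near_N[OF xy(1)] by simp
  then obtain c' where c': "coloring_on (D + 2) E (insert y (- {x, y})) c'"
    using color_one_more[OF c] by auto
  have "card (near E x) \<le> D + 1" using card_near_2[OF x(2,3)] y da by simp
  then have "\<exists>c. coloring_on (D + 2) E (insert y (- {x, y}) \<union> {x}) c"
    by (intro color_greedily[OF c']) auto
  moreover have "insert y (- {x, y}) \<union> {x} = UNIV" by auto
  ultimately show False using uncolorable by simp
qed

lemma card_near_weak: "weak v \<Longrightarrow> card (near E v) \<le> D + 1"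
proof -
  assume w: "weak v"
  let ?T = "{w \<in> N v. d w = 2}"
  have "(\<Sum>m\<in>N v. d m) \<le> (\<Sum>m\<in>N v. if d m = 2 then 2 else 3)"
    using w by (intro sum_mono) (auto simp: weak_def)
  also have "\<dots> + card ?T = (\<Sum>m\<in>N v. (if d m = 2 then 2 else 3) + (if d m = 2 then 1 else 0))"
    by (simp add: sum.distrib sum.inter_filter[symmetric])
  also have "\<dots> = (\<Sum>m\<in>N v. 3)" by (intro sum.cong) auto
  finally have "(\<Sum>m\<in>N v. d m) + card ?T \<le> 9" using w by (simp add: weak_def)
  then show ?thesis using card_near_le[of v] w D by (simp add: weak_def)
qed

text \<open>
  Suppose that \<open>a\<close> has degree below \<open>D\<close>. Uncolour \<open>v\<close>, \<open>x\<close> and a second neighbour \<open>z\<close> of \<open>v\<close> of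
  degree 2. The vertices \<open>z\<close>, \<open>x\<close>, \<open>v\<close> have at most \<open>D + 3\<close>, \<open>D + 2\<close> and \<open>D + 1\<close> conflicts, of which
  at least 2, 1 and 0 are with uncoloured vertices when they are recoloured in this order.
\<close>

lemma nbr_of_weak:
  assumes v: "weak v" and x: "d x = 2" "N x = {a, v}" "a \<noteq> v"
  shows "d a = D"
proof (rule ccontr)
  assume "d a \<noteq> D"
  then have da: "d a < D" using deg[of a] by simp
  have dv: "d v = 3" using v by (simp add: weak_def)
  have xv: "x \<in> N v" "v \<in> N x" using x N_sym by auto
  have "\<exists>z\<in>{w \<in> N v. d w = 2}. z \<noteq> x"
    using v by (intro another_element) (simp add: weak_def)
  then obtain z where z: "z \<noteq> x" "z \<in> N v" "d z = 2" by blast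
  then have vz: "v \<in> N z" using N_sym by blast
  obtain b where b: "N z = {b, v}" "b \<noteq> v" using two_nbrs[OF z(3) vz] .
  have ne: "v \<noteq> x" "v \<noteq> z" using xv z N_irr by auto
  let ?S = "- {v, x, z}"
  obtain c where c: "coloring_on (D + 2) E ?S c" using uncolor_set[of x "{v,x,z}" v] xv(2) by blast
  have "card (near E z) \<le> D + 3" using card_near_2[OF b] dv deg[of b] by simp
  moreover have "{v, x} \<subseteq> near E z" using near_N[OF vz] near_2[OF vz xv(1)] z by auto
  ultimately have "card (near E z \<inter> ?S) \<le> D + 1"
    using card_near_minus[of "{v, x}" z ?S] ne by auto
  then obtain c1 where c1: "coloring_on (D + 2) E (insert z ?S) c1"
    using color_one_more[OF c] by auto
  have "card (near E x) \<le> D + 2" using card_near_2[OF x(2,3)] dv da by simp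
  then have "card (near E x \<inter> insert z ?S) \<le> D + 1"
    using card_near_minus[of "{v}" x "insert z ?S"] near_N[OF xv(2)] ne by auto
  then obtain c2 where c2: "coloring_on (D + 2) E (insert x (insert z ?S)) c2"
    using color_one_more[OF c1, of x] z(1) by auto
  have "\<exists>c. coloring_on (D + 2) E (insert x (insert z ?S) \<union> {v}) c"
    using card_near_weak[OF v] by (intro color_greedily[OF c2]) auto
  moreover have "insert x (insert z ?S) \<union> {v} = UNIV" by auto
  ultimately show False using uncolorable by simp
qed

section \<open>Special vertices form a forest\<close>

definition special :: "'a set" where
  "special = {x. d x = 2 \<and> (\<exists>p\<in>N x. d p = 2 \<or> weak p)}"

definition big :: "'a \<Rightarrow> 'a" where
  "big x = (SOME a. a \<in> N x \<and> d a = D)"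

definition light :: "'a \<Rightarrow> 'a" where
  "light x = (SOME p. p \<in> N x \<and> d p \<le> 3)"

text \<open>
  A hub is one side of the incidence structure; it is a set so that two adjacent special vertices,
  which play symmetric roles, share the same hub.
\<close>

definition hub :: "'a \<Rightarrow> 'a set" where
  "hub x = (if d (light x) = 2 then {x, light x} else {light x})"

text \<open>
  This makes the two choices in \<open>big\<close> and \<open>light\<close> unique: the neighbours of a special vertex are told
  apart by their degrees, \<open>D\<close> and at most 3.
\<close>

lemma special_nbrs:
  assumes x: "x \<in> special"
  shows "N x = {big x, light x}" "d (big x) = D" "d (light x) = 2 \<or> weak (light x)"
proof -
  obtain p where p: "p \<in> N x" "d p = 2 \<or> weak p" and dx: "d x = 2"
    using x by (auto simp: special_def)
  obtain a where a: "N x = {a, p}" "a \<noteq> p" using two_nbrs[OF dx p(1)] .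
  have da: "d a = D"
    using p(2) adjacent_2_vertices[OF dx a] nbr_of_weak[OF _ dx a] by blast
  have dp: "d p \<le> 3" using p(2) by (auto simp: weak_def)
  have "big x = a" unfolding big_def
    using a(1) da dp D by (intro some_equality) auto
  moreover have "light x = p" unfolding light_def
    using a(1) da dp D by (intro some_equality) auto
  ultimately show "N x = {big x, light x}" "d (big x) = D" "d (light x) = 2 \<or> weak (light x)"
    using a da p by simp_all
qed

lemma special_degree: "x \<in> special \<Longrightarrow> d x = 2"
  by (simp add: special_def)

lemma light_degree: "x \<in> special \<Longrightarrow> d (light x) \<le> 3"
  using special_nbrs(3)[of x] by (auto simp: weak_def)

lemma light_unique:
  assumes x: "x \<in> special" and p: "p \<in> N x" "d p \<le> 3"
  shows "light x = p"
  using special_nbrs(1,2)[OF x] p D by auto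

lemma big_unique:
  assumes x: "x \<in> special" and a: "a \<in> N x" "d a = D"
  shows "big x = a"
  using special_nbrs(1)[OF x] light_degree[OF x] a D by auto

lemma light_special:
  assumes x: "x \<in> special" and l: "d (light x) = 2"
  shows "light x \<in> special" "light (light x) = x" "hub (light x) = hub x" "light x \<noteq> x"
proof -
  have xl: "light x \<in> N x" using special_nbrs(1)[OF x] by auto
  then have lx: "x \<in> N (light x)" using N_sym by blast
  show s: "light x \<in> special" using l lx special_degree[OF x] by (auto simp: special_def)
  show ll: "light (light x) = x" using light_unique[OF s lx] special_degree[OF x] by simp
  show "hub (light x) = hub x"
    using l ll special_degree[OF x] by (simp add: hub_def insert_commute)
  show "light x \<noteq> x" using xl N_irr by metis
qed

lemma nbr_of_weak_special:
  assumes "weak v" "x \<in> N v" "d x = 2"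
  shows "x \<in> special" "light x = v" "hub x = {v}"
proof -
  have vx: "v \<in> N x" using assms N_sym by blast
  show s: "x \<in> special" using assms vx by (auto simp: special_def)
  show l: "light x = v" using light_unique[OF s vx] assms(1) by (simp add: weak_def)
  show "hub x = {v}" using l assms(1) by (simp add: hub_def weak_def)
qed

lemma finite_nonisolated: "finite {v. N v \<noteq> {}}"
proof -
  have "{v. N v \<noteq> {}} \<subseteq> Domain E" by (auto simp: nbrs_def)
  then show ?thesis using fin finite_Domain finite_subset by blast
qed

lemma finite_special: "finite special"
  by (rule finite_subset[OF _ finite_nonisolated]) (auto simp: special_def)

text \<open>
  A set \<open>Y\<close> of special vertices in which all degrees of the incidence structure are 2 is a union of
  cycles. Uncolour it together with the weak vertices on it. In \<open>Y\<close>, two vertices conflict only if they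
  share their neighbour of degree \<open>D\<close> or their hub, and every vertex of \<open>Y\<close> sees at most \<open>D\<close>
  coloured vertices, so that two colours are left for it. After \<open>Y\<close> has been coloured as a union of
  even cycles, the weak vertices are coloured greedily.
\<close>

lemma no_core:
  assumes Y: "Y \<subseteq> special" "Y \<noteq> {}"
    and two: "\<And>y. y \<in> Y \<Longrightarrow> card {z \<in> Y. big z = big y} = 2"
      "\<And>y. y \<in> Y \<Longrightarrow> card {z \<in> Y. hub z = hub y} = 2"
  shows False
proof -
  define U where "U = Y \<union> light ` Y"
  have finY: "finite Y" using Y(1) finite_special finite_subset by blast
  have sp: "y \<in> special" if "y \<in> Y" for y using Y that by blast
  \<comment> \<open>with a special vertex, \<open>Y\<close> contains its special neighbour, the only other vertex with the same hub\<close>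
  have lightY: "light y \<in> Y" if y: "y \<in> Y" and l: "d (light y) = 2" for y
  proof -
    obtain z where z: "z \<in> Y" "z \<noteq> y" "hub z = hub y"
      using another_element[of "{z \<in> Y. hub z = hub y}" y] two(2)[OF y] by auto
    have "z \<in> hub y"
    proof (cases "d (light z) = 2")
      case True then show ?thesis using z(3) by (auto simp: hub_def)
    next
      case False
      then have "{light z} = {y, light y}" using z(3) l unfolding hub_def by presburger
      then have "light y = y" by blast
      then show ?thesis using light_special(4)[OF sp[OF y] l] by contradiction
    qed
    then show ?thesis using z(1,2) l by (auto simp: hub_def)
  qed
  \<comment> \<open>the cycle neighbour \<open>z\<close> at \<open>big y\<close>, the vertex \<open>light y\<close> and the cycle neighbour at the hub are uncoloured\<close>
  have few: "card (near E y \<inter> - U) \<le> D" if y: "y \<in> Y" for y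
  proof -
    note s = special_nbrs[OF sp[OF y]]
    obtain z where z: "z \<in> Y" "z \<noteq> y" "big z = big y"
      using another_element[of "{z \<in> Y. big z = big y}" y] two(1)[OF y] by auto
    have yb: "y \<in> N (big y)" using s(1) N_sym by blast
    have "big z \<in> N z" using special_nbrs(1)[OF sp[OF z(1)]] by simp
    then have zb: "z \<in> N (big y)" using z(3) N_sym by metis
    \<comment> \<open>\<open>?A\<close> bounds what \<open>y\<close> sees through \<open>big y\<close>, and \<open>?B\<close> what it sees through \<open>light y\<close>\<close>
    let ?A = "insert (big y) (N (big y) - {y, z})"
    let ?B = "N (light y) - {y} - U"
    have "card (N (big y) - {y, z}) = D - 2"
      using yb zb z(2) s(2) by (subst card_Diff_subset) auto
    then have A: "card ?A \<le> D - 1"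
      using card_insert_le_m1[of "D - 1" "N (big y) - {y, z}" "big y"] D by (simp add: card_insert_if)
    have yl: "y \<in> N (light y)" using s(1) N_sym by blast
    have B: "card ?B \<le> 1"
    proof (cases "d (light y) = 2")
      case True
      have "card ?B \<le> card (N (light y) - {y})" by (intro card_mono) auto
      then show ?thesis using True yl by simp
    next
      case False
      then have w: "d (light y) = 3" using s(3) by (auto simp: weak_def)
      obtain x where x: "x \<in> Y" "x \<noteq> y" "hub x = hub y"
        using another_element[of "{z \<in> Y. hub z = hub y}" y] two(2)[OF y] by auto
      have "d (light x) \<noteq> 2"
      proof
        assume l: "d (light x) = 2"
        then have "{x, light x} = {light y}" using x(3) False unfolding hub_def by presburger
        then have "light x = x" by blast
        then show False using light_special(4)[OF sp[OF x(1)] l] by contradiction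
      qed
      then have "light x = light y" using x(3) False by (simp add: hub_def)
      moreover have "light x \<in> N x" using special_nbrs(1)[OF sp[OF x(1)]] by simp
      ultimately have xl: "x \<in> N (light y)" using N_sym by metis
      have "card ?B \<le> card (N (light y) - {y, x})" using x(1) by (intro card_mono) (auto simp: U_def)
      also have "\<dots> = 1" using yl xl x(2) w by (subst card_Diff_subset) auto
      finally show ?thesis .
    qed
    have "near E y \<inter> - U \<subseteq> ?A \<union> ?B"
    proof
      fix w assume w: "w \<in> near E y \<inter> - U"
      then obtain m where m: "m \<in> N y" "w = m \<or> w \<in> N m" "w \<noteq> y" by (auto simp: near_def)
      have "w \<noteq> z" "w \<noteq> light y" using w z(1) y by (auto simp: U_def)
      then show "w \<in> ?A \<union> ?B" using m w s(1) by auto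
    qed
    then have "card (near E y \<inter> - U) \<le> card (?A \<union> ?B)" by (intro card_mono) auto
    also have "\<dots> \<le> card ?A + card ?B" by (rule card_Un_le)
    finally show ?thesis using A B D by linarith
  qed
  obtain y0 where y0: "y0 \<in> Y" using Y(2) by blast
  have "light y0 \<in> N y0" using special_nbrs(1)[OF sp[OF y0]] by simp
  then obtain c where c: "coloring_on (D + 2) E (- U) c"
    using uncolor_set[of y0 U "light y0"] y0 by (auto simp: U_def)
  define L where "L = (\<lambda>y. {1..D + 2} - c ` (near E y \<inter> - U))"
  have L: "finite (L y) \<and> 2 \<le> card (L y)" if y: "y \<in> Y" for y
  proof -
    have "card (c ` (near E y \<inter> - U)) \<le> D"
      using few[OF y] card_image_le[of "near E y \<inter> - U" c] by simp
    then have "2 \<le> card {1..D + 2} - card (c ` (near E y \<inter> - U))" by simp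
    also have "\<dots> \<le> card (L y)" unfolding L_def by (rule diff_card_le_card_Diff) simp
    finally show ?thesis by (simp add: L_def)
  qed
  have conf: "big z = big y \<or> hub z = hub y" if y: "y \<in> Y" and z: "z \<in> Y" and n: "z \<in> near E y" for y z
  proof -
    note s = special_nbrs[OF sp[OF y]]
    have dz: "d z = 2" using special_degree[OF sp[OF z]] .
    obtain m where m: "m \<in> N y" "z = m \<or> z \<in> N m" "z \<noteq> y" using n by (auto simp: near_def)
    consider "m = big y" | "m = light y" "z = m" | "m = light y" "z \<in> N m" using m s(1) by blast
    then show ?thesis
    proof cases
      case 1
      then have "z \<in> N (big y)" using m dz s(2) D by auto
      then have "big y \<in> N z" using N_sym by blast
      then show ?thesis using big_unique[OF sp[OF z]] s(2) by blast
    next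
      case 2
      then show ?thesis using light_special(3)[OF sp[OF y]] dz by simp
    next
      case 3
      show ?thesis
      proof (cases "d (light y) = 2")
        case True
        note ls = light_special[OF sp[OF y] True]
        have "N (light y) = {big (light y), y}" using special_nbrs(1)[OF ls(1)] ls(2) by simp
        then have "z = big (light y)" using 3 m(3) by auto
        then show ?thesis using special_nbrs(2)[OF ls(1)] dz D by simp
      next
        case False
        then have "weak (light y)" using s(3) by blast
        then have "hub z = {light y}" using nbr_of_weak_special(3) 3 dz by blast
        then show ?thesis using False by (simp add: hub_def)
      qed
    qed
  qed
  have "\<exists>e. \<forall>y\<in>Y. e y \<in> L y \<and>
      (\<forall>z\<in>Y. z \<noteq> y \<and> (big z = big y \<or> hub z = hub y) \<longrightarrow> e z \<noteq> e y)"
    by (rule list_coloring_two_regular[where a = big and h = hub and L = L, OF finY])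
      (erule two L)+
  then obtain e where e: "\<And>y. y \<in> Y \<Longrightarrow> e y \<in> L y"
    "\<And>y z. y \<in> Y \<Longrightarrow> z \<in> Y \<Longrightarrow> z \<noteq> y \<Longrightarrow> big z = big y \<or> hub z = hub y \<Longrightarrow> e z \<noteq> e y"
    by blast
  define c1 where "c1 = (\<lambda>v. if v \<in> Y then e v else c v)"
  have YU: "Y \<subseteq> U" by (auto simp: U_def)
  have "coloring_on (D + 2) E (- U \<union> Y) c1"
    unfolding coloring_on_def
  proof (intro ballI conjI)
    fix u assume u: "u \<in> - U \<union> Y"
    show "c1 u \<in> {1..D + 2}"
      using u c e(1)[of u] YU by (auto simp: c1_def L_def coloring_on_def)
    fix w assume w: "w \<in> near E u \<inter> (- U \<union> Y)"
    have wu: "w \<noteq> u" using w by (auto simp: near_def)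
    have uw: "u \<in> near E w" using w near_sym[OF sym, of w u] by blast
    consider "u \<in> Y" "w \<in> Y" | "u \<in> Y" "w \<in> - U" | "u \<in> - U" "w \<in> Y" | "u \<in> - U" "w \<in> - U"
      using u w by blast
    then show "c1 w \<noteq> c1 u"
    proof cases
      case 1
      then show ?thesis using conf[of u w] e(2)[of u w] w wu by (simp add: c1_def)
    next
      case 2
      then have "c w \<in> c ` (near E u \<inter> - U)" using w by blast
      then show ?thesis using 2 YU e(1)[of u] by (auto simp: c1_def L_def)
    next
      case 3
      then have "c u \<in> c ` (near E w \<inter> - U)" using uw by blast
      then show ?thesis using 3 YU e(1)[of w] by (auto simp: c1_def L_def)
    next
      case 4
      then have "c w \<noteq> c u" using c w by (auto simp: coloring_on_def)
      then show ?thesis using 4 YU by (auto simp: c1_def)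
    qed
  qed
  then have "\<exists>c2. coloring_on (D + 2) E (- U \<union> Y \<union> (light ` Y - Y)) c2"
  proof (rule color_greedily)
    show "finite (light ` Y - Y)" using finY by simp
    fix w assume w: "w \<in> light ` Y - Y"
    obtain y where y: "y \<in> Y" "w = light y" using w by blast
    then have "d (light y) \<noteq> 2" using lightY[OF y(1)] w by auto
    then have "weak w" using special_nbrs(3)[OF sp[OF y(1)]] y(2) by simp
    then show "card (near E w) \<le> D + 1" by (rule card_near_weak)
  qed
  then obtain c2 where "coloring_on (D + 2) E (- U \<union> Y \<union> (light ` Y - Y)) c2"
    by blast
  moreover have "- U \<union> Y \<union> (light ` Y - Y) = UNIV" by (auto simp: U_def)
  ultimately show False using uncolorable by simp
qed

text \<open>
  Write \<open>s\<close>, \<open>h\<close> and \<open>k\<close> for the numbers of special vertices, of hubs and of vertices of degree \<open>D\<close>. The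
  forest gives \<open>s \<le> k + h\<close>, and \<open>2 h \<le> s\<close> since each hub serves at least two special vertices; hence
  \<open>s \<le> 2 k\<close>.
\<close>

lemma card_special_le: "card special \<le> 2 * card {v. d v = D}"
proof (cases "special = {}")
  case False
  have "{v. d v = D} \<subseteq> {v. N v \<noteq> {}}" using D by auto
  then have finD: "finite {v. d v = D}" using finite_nonisolated finite_subset by blast
  have "\<not> card (big ` special) + card (hub ` special) \<le> card special"
    using two_regular_core[OF finite_special False, of big hub] no_core by blast
  moreover have "card (big ` special) \<le> card {v. d v = D}"
    using finD special_nbrs(2) by (intro card_mono) auto
  moreover have "2 * card (hub ` special) \<le> card special"
  proof -
    have cls: "2 \<le> card {z \<in> special. hub z = h}" if h: "h \<in> hub ` special" for h
    proof -
      obtain x where x: "x \<in> special" "h = hub x" using h by blast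
      have "\<exists>z\<in>special. z \<noteq> x \<and> hub z = hub x"
      proof (cases "d (light x) = 2")
        case True then show ?thesis using light_special[OF x(1) True] by blast
      next
        case False
        then have w: "weak (light x)" using special_nbrs(3)[OF x(1)] by blast
        then have "\<exists>z\<in>{w \<in> N (light x). d w = 2}. z \<noteq> x"
          by (intro another_element) (simp add: weak_def)
        then obtain z where z: "z \<in> N (light x)" "d z = 2" "z \<noteq> x" by blast
        then show ?thesis
          using nbr_of_weak_special[OF w z(1,2)] False by (intro bexI[of _ z]) (auto simp: hub_def)
      qed
      then obtain z where "z \<in> special" "z \<noteq> x" "hub z = hub x" by blast
      then have "card {x, z} = 2" "{x, z} \<subseteq> {z \<in> special. hub z = h}" using x by auto
      then show ?thesis using card_mono[of "{z \<in> special. hub z = h}" "{x, z}"] finite_special by simp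
    qed
    have "card special = (\<Sum>h\<in>hub ` special. card {z \<in> special. hub z = h})"
      using sum.image_gen[OF finite_special, of "\<lambda>_. 1::nat" hub] by simp
    also have "\<dots> \<ge> (\<Sum>h\<in>hub ` special. 2)" by (intro sum_mono cls)
    finally show ?thesis by simp
  qed
  ultimately show ?thesis by linarith
qed simp

section \<open>Discharging\<close>

definition send :: "'a \<Rightarrow> 'a \<Rightarrow> int" where
  "send u v = (if 4 \<le> d u \<and> d v \<le> 3 \<or> d u = 3 \<and> \<not> weak u \<and> d v = 2 then 1 else 0)"

definition final :: "'a \<Rightarrow> int" where
  "final v = 3 * int (d v) - 8 + (\<Sum>u\<in>N v. send u v) - (\<Sum>u\<in>N v. send v u)"

lemma sum_indicator_N: "(\<Sum>u\<in>N v. if P u then 1 else 0 :: int) = int (card {u \<in> N v. P u})"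
  by (simp add: sum.inter_filter[symmetric])

text \<open>
  A vertex of degree 3 that is not weak has either at most one neighbour of degree 2, or two of them and
  a neighbour of degree at least 4 that gives 1 to it; its initial charge 1 covers the rest. A
  vertex of degree 2 needs 2: it gets 1 from each neighbour, except that a special vertex is sure only
  of the 1 from its neighbour of degree \<open>D\<close>.
\<close>

lemma final_ge:
  assumes "N v \<noteq> {}"
  shows "(if d v = D then 4 else 0) - (if v \<in> special then 1 else 0) \<le> final v"
proof -
  have d2: "2 \<le> d u" if "N u \<noteq> {}" for u
  proof -
    have "d u \<noteq> 0" using that by simp
    then show ?thesis using degree_ne_1[of u] by linarith
  qed
  have inc: "0 \<le> (\<Sum>u\<in>N v. send u v)" by (intro sum_nonneg) (simp add: send_def)
  consider "4 \<le> d v" | "d v = 3" | "d v = 2" using d2[OF assms] by linarith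
  then show ?thesis
  proof cases
    case 1
    have "(\<Sum>u\<in>N v. send v u) \<le> (\<Sum>u\<in>N v. 1)" by (intro sum_mono) (simp add: send_def)
    then have "(\<Sum>u\<in>N v. send v u) \<le> int (d v)" by simp
    moreover have "v \<notin> special" using 1 by (auto simp: special_def)
    ultimately show ?thesis using inc 1 D unfolding final_def by auto
  next
    case 2
    have ns: "v \<notin> special" "d v \<noteq> D" using 2 D by (auto simp: special_def)
    show ?thesis
    proof (cases "weak v")
      case True
      then have "(\<Sum>u\<in>N v. send v u) = 0" using 2 by (intro sum.neutral) (simp add: send_def)
      then show ?thesis using inc 2 ns unfolding final_def by simp
    next
      case False
      let ?T = "{u \<in> N v. d u = 2}" and ?F = "{u \<in> N v. 4 \<le> d u}"
      have "(\<Sum>u\<in>N v. send v u) = (\<Sum>u\<in>N v. if d u = 2 then 1 else 0)"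
        using 2 False by (intro sum.cong) (auto simp: send_def)
      then have out: "(\<Sum>u\<in>N v. send v u) = int (card ?T)" by (simp only: sum_indicator_N)
      have "(\<Sum>u\<in>N v. send u v) = (\<Sum>u\<in>N v. if 4 \<le> d u then 1 else 0)"
        using 2 by (intro sum.cong) (auto simp: send_def)
      then have inn: "(\<Sum>u\<in>N v. send u v) = int (card ?F)" by (simp only: sum_indicator_N)
      have "card ?T \<le> 1 + card ?F"
      proof (cases "?F = {}")
        case True
        then have "\<forall>w\<in>N v. d w \<le> 3" by fastforce
        then show ?thesis using False 2 by (simp add: weak_def)
      next
        case ne: False
        then have "1 \<le> card ?F" by (simp add: Suc_le_eq card_gt_0_iff)
        moreover have "card ?T + card ?F = card (?T \<union> ?F)"
          by (intro card_Un_disjoint[symmetric]) auto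
        moreover have "card (?T \<union> ?F) \<le> d v" by (intro card_mono) auto
        ultimately show ?thesis using 2 by linarith
      qed
      then show ?thesis using out inn 2 ns unfolding final_def by simp
    qed
  next
    case 3
    have out: "(\<Sum>u\<in>N v. send v u) = 0" using 3 by (intro sum.neutral) (simp add: send_def)
    have nD: "d v \<noteq> D" using 3 D by simp
    show ?thesis
    proof (cases "v \<in> special")
      case True
      note s = special_nbrs[OF True]
      have "send (big v) v \<le> (\<Sum>u\<in>N v. send u v)"
        using s(1) by (intro member_le_sum) (auto simp: send_def)
      moreover have "send (big v) v = 1" using s(2) 3 D by (simp add: send_def)
      ultimately show ?thesis using out 3 nD True unfolding final_def by simp
    next
      case False
      have "send u v = 1" if u: "u \<in> N v" for u
      proof -
        have "v \<in> N u" using u N_sym by blast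
        then have "2 \<le> d u" by (intro d2) auto
        moreover have "d u \<noteq> 2" "\<not> weak u" using False 3 u by (auto simp: special_def)
        ultimately show ?thesis using 3 by (auto simp: send_def)
      qed
      then have "(\<Sum>u\<in>N v. send u v) = 2" using 3 by simp
      then show ?thesis using out 3 nD False unfolding final_def by simp
    qed
  qed
qed

lemma dense: "8 * card (Domain E) \<le> 3 * card E"
proof -
  let ?V = "Domain E"
  have V: "?V = {v. N v \<noteq> {}}" by (auto simp: nbrs_def)
  have finV: "finite ?V" using fin by (rule finite_Domain)
  have "E = Sigma ?V N" by (auto simp: nbrs_def)
  then have "card E = (\<Sum>v\<in>?V. d v)" using card_SigmaI[OF finV, of N] by simp
  then have edges: "int (card E) = (\<Sum>v\<in>?V. int (d v))" by simp
  have out: "N v = {u \<in> ?V. (v, u) \<in> E}" for v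
    using sym by (auto simp: nbrs_def dest: symD)
  have inn: "N v = {u \<in> ?V. (u, v) \<in> E}" for v
    using sym by (auto simp: nbrs_def dest: symD)
  have "(\<Sum>v\<in>?V. \<Sum>u\<in>N v. send v u) = (\<Sum>v\<in>?V. \<Sum>u\<in>{u \<in> ?V. (v, u) \<in> E}. send v u)"
    by (simp only: out)
  also have "\<dots> = (\<Sum>u\<in>?V. \<Sum>v\<in>{v \<in> ?V. (v, u) \<in> E}. send v u)"
    by (rule sum.swap_restrict[OF finV finV])
  also have "\<dots> = (\<Sum>u\<in>?V. \<Sum>v\<in>N u. send v u)" by (simp only: inn)
  finally have "(\<Sum>v\<in>?V. final v) = 3 * int (card E) - 8 * int (card ?V)"
    by (simp add: final_def sum.distrib sum_subtractf edges sum_distrib_left)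
  moreover have "(\<Sum>v\<in>?V. (if d v = D then 4 else 0) - (if v \<in> special then 1 else 0)) \<le> (\<Sum>v\<in>?V. final v)"
    by (intro sum_mono final_ge) (simp add: V)
  moreover have "(\<Sum>v\<in>?V. (if d v = D then 4 else 0) - (if v \<in> special then 1 else 0 :: int))
      = 4 * int (card {v. d v = D}) - int (card special)"
  proof -
    have "{v \<in> ?V. d v = D} = {v. d v = D}" "?V \<inter> special = special"
      using D by (auto simp: V special_def)
    moreover have "(\<Sum>v\<in>?V. if v \<in> special then 1 else 0 :: int) = int (card (?V \<inter> special))"
      using finV by (simp add: sum.If_cases)
    moreover have "(\<Sum>v\<in>?V. if d v = D then 4 else 0 :: int) = 4 * int (card {v \<in> ?V. d v = D})"
      using finV by (simp add: sum.inter_filter[symmetric])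
    ultimately show ?thesis by (simp add: sum_subtractf)
  qed
  ultimately show ?thesis using card_special_le by linarith
qed

end

section \<open>From critical graphs to the maximum average degree\<close>

text \<open>
  The density bound is stated for arc sets and the vertices that they cover, so that it passes to all
  subsets of \<open>E\<close>; this reduces the claim to critical graphs.
\<close>

lemma sparse_colorable:
  assumes "finite E" "sym E" "irrefl E" "\<And>v. card (nbrs E v) \<le> D" "6 \<le> D"
    and "\<And>F. F \<subseteq> E \<Longrightarrow> sym F \<Longrightarrow> F \<noteq> {} \<Longrightarrow> 3 * card F < 8 * card (Domain F)"
  shows "\<exists>c. coloring_on (D + 2) E UNIV c"
  using assms
proof (induction "card E" arbitrary: E rule: less_induct)
  case less
  show ?case
  proof (rule ccontr)
    assume no: "\<not> ?thesis"
    have finN: "finite (nbrs E v)" for v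
    proof -
      have "nbrs E v \<subseteq> Range E" by (auto simp: nbrs_def)
      then show ?thesis using less.prems(1) finite_Range finite_subset by blast
    qed
    interpret critical_graph E D
    proof
      fix F assume F: "F \<subset> E" "sym F"
      show "\<exists>c. coloring_on (D + 2) F UNIV c"
      proof (rule less.hyps)
        show "card F < card E" using F less.prems(1) by (intro psubset_card_mono)
        show "finite F" using F less.prems(1) finite_subset by blast
        show "sym F" by (rule F)
        show "irrefl F" using F less.prems(3) by (auto simp: irrefl_def)
        show "card (nbrs F v) \<le> D" for v
        proof -
          have "nbrs F v \<subseteq> nbrs E v" using F by (auto simp: nbrs_def)
          then show ?thesis using card_mono[OF finN] less.prems(4) le_trans by blast
        qed
        show "6 \<le> D" by (rule less.prems)
        show "3 * card H < 8 * card (Domain H)" if "H \<subseteq> F" "sym H" "H \<noteq> {}" for H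
          using less.prems(6)[of H] F that by blast
      qed
    next
      show "\<not> coloring_on (D + 2) E UNIV c" for c using no by blast
    qed (fact less.prems)+
    have "E \<noteq> {}"
    proof
      assume "E = {}"
      then have "coloring_on (D + 2) E UNIV (\<lambda>_. 1)" by (auto simp: coloring_on_def near_def nbrs_def)
      then show False using no by blast
    qed
    then show False using less.prems(6)[of E] less.prems(2) dense by simp
  qed
qed

text \<open>
  Each undirected edge is the image of two opposite arcs.
\<close>

lemma card_uedges:
  assumes "pair_graph H"
  shows "card (parcs H) = 2 * card (uedges H)"
proof -
  interpret pair_graph H by fact
  let ?f = "\<lambda>(u, v). {u, v}"
  have fiber: "card {e \<in> parcs H. ?f e = s} = 2" if s: "s \<in> uedges H" for s
  proof -
    obtain u v where uv: "(u, v) \<in> parcs H" "s = {u, v}" using s by (auto simp: uedges_def)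
    have vu: "(v, u) \<in> parcs H" using uv(1) by (rule arcs_symmetric)
    have ne: "u \<noteq> v" using no_loops[OF uv(1)] by simp
    have "(x, y) = (u, v) \<or> (x, y) = (v, u)" if "{x, y} = {u, v}" for x y
      using that by (auto simp: doubleton_eq_iff)
    then have "{e \<in> parcs H. ?f e = s} = {(u, v), (v, u)}"
      using uv vu by fast
    then show ?thesis using ne by simp
  qed
  have "card (parcs H) = (\<Sum>s\<in>?f ` parcs H. card {e \<in> parcs H. ?f e = s})"
    using sum.image_gen[OF pair_finite_arcs, of "\<lambda>_. 1::nat" ?f] by simp
  also have "\<dots> = (\<Sum>s\<in>uedges H. 2)" unfolding uedges_def[symmetric] by (intro sum.cong fiber) auto
  finally show ?thesis by simp
qed

theorem theorem3:
  fixes G :: "'a pair_pre_digraph"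
  assumes "pair_graph G"
    and "max_degree G \<ge> 6"
    and "mad G < 8 / 3"
  shows "\<exists>\<phi>. two_distance_coloring G (max_degree G + 2) \<phi>"
proof (cases "pverts G = {}")
  case True
  then show ?thesis by (simp add: two_distance_coloring_def)
next
  case False
  interpret pair_graph G by (rule assms(1))
  define D where "D = max_degree G"
  have sym: "sym (parcs G)" by (auto intro: symI arcs_symmetric)
  have out: "out_degree (with_proj G) v = card (nbrs (parcs G) v)" for v
  proof -
    have "out_arcs (with_proj G) v = Pair v ` nbrs (parcs G) v"
      by (auto simp: out_arcs_def nbrs_def)
    then show ?thesis by (simp add: out_degree_def card_image inj_on_def)
  qed
  have deg: "card (nbrs (parcs G) v) \<le> D" for v
  proof (cases "v \<in> pverts G")
    case True
    then show ?thesis unfolding D_def max_degree_def out[symmetric] by (intro Max_ge) auto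
  next
    case False
    then have "nbrs (parcs G) v = {}" using in_arcsD1 by (auto simp: nbrs_def)
    then show ?thesis by simp
  qed
  have sparse: "3 * card F < 8 * card (Domain F)" if F: "F \<subseteq> parcs G" "sym F" "F \<noteq> {}" for F
  proof -
    define H where "H = \<lparr>pverts = Domain F, parcs = F\<rparr>"
    have fF: "finite F" using F(1) pair_finite_arcs finite_subset by blast
    have H: "pair_graph H"
    proof
      fix e assume e: "e \<in> parcs H"
      then have eF: "(fst e, snd e) \<in> F" by (simp add: H_def)
      show "fst e \<in> pverts H" using DomainI[OF eF] by (simp add: H_def)
      show "snd e \<in> pverts H" using DomainI[OF symD[OF F(2) eF]] by (simp add: H_def)
      have "e \<in> parcs G" using e F(1) by (auto simp: H_def)
      then show "fst e \<noteq> snd e" by (rule no_loops)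
    next
      show "finite (pverts H)" "finite (parcs H)" using fF by (simp_all add: H_def finite_Domain)
      show "symmetric (with_proj H)" unfolding symmetric_conv
      proof
        fix e assume "e \<in> arcs (with_proj H)"
        then have "(snd e, fst e) \<in> F" using symD[OF F(2), of "fst e" "snd e"] by (simp add: H_def)
        then show "\<exists>e'\<in>arcs (with_proj H). tail (with_proj H) e = head (with_proj H) e' \<and>
            head (with_proj H) e = tail (with_proj H) e'"
          by (intro bexI[of _ "(snd e, fst e)"]) (simp_all add: H_def)
      qed
    qed
    interpret H: pair_graph H by (rule H)
    have dom: "Domain F \<subseteq> pverts G" using F(1) in_arcsD1 by blast
    have "H \<in> nonempty_subgraphs G"
      unfolding nonempty_subgraphs_def subgraph_def
    proof (intro CollectI conjI)
      show "pair_graph H" by (rule H)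
      show "pverts H \<noteq> {}" using F(3) by (auto simp: H_def)
      show "verts (with_proj H) \<subseteq> verts (with_proj G)" using dom by (simp add: H_def)
      show "arcs (with_proj H) \<subseteq> arcs (with_proj G)" using F(1) by (simp add: H_def)
      show "wf_digraph (with_proj G)" "wf_digraph (with_proj H)" by unfold_locales
      show "compatible (with_proj G) (with_proj H)" by (simp add: compatible_def)
    qed
    then have bound: "2 * real (card (uedges H)) / real (card (pverts H)) < 8 / 3"
      using assms(3) unfolding mad_less_iff[OF assms(1) False] by (rule bspec[rotated])
    have "0 < card (Domain F)" using F(3) fF by (auto simp: card_gt_0_iff finite_Domain Domain_empty_iff)
    moreover have "card F = 2 * card (uedges H)" using card_uedges[OF H] by (simp add: H_def)
    ultimately show ?thesis using bound by (simp add: H_def divide_less_eq)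
  qed
  have "irrefl (parcs G)" using no_loops by (force intro: irreflI)
  moreover have "6 \<le> D" using assms(2) by (simp add: D_def)
  ultimately obtain c where c: "coloring_on (D + 2) (parcs G) UNIV c"
    using sparse_colorable[OF pair_finite_arcs sym _ deg _ sparse] by blast
  have "two_distance_coloring G (D + 2) c"
    unfolding two_distance_coloring_def
  proof (intro conjI ballI impI)
    show "c ` pverts G \<subseteq> {1..D + 2}" using c by (auto simp: coloring_on_def)
    fix x y assume xy: "x \<in> pverts G" "y \<in> pverts G" "x \<noteq> y \<and> graph_dist G x y \<le> 2"
    then have "y \<in> near (parcs G) x"
      using graph_dist_le_2_iff[OF assms(1), of x y] by (auto simp: near_def nbrs_def)
    then have "c y \<noteq> c x" using c unfolding coloring_on_def by blast
    then show "c x \<noteq> c y" by (rule not_sym)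
  qed
  then show ?thesis by (auto simp: D_def)
qed

end
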